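(* Let $(\alpha_n)_{n \in \mathbb{N}}$ be a sequence of pairwise distinct positive irrational numbers such that the set $\{1, \alpha_n \mid n \in \mathbb{N}\}$ is linearly independent over $\mathbb{Q}$ and $\sum_{n=1}^\infty \alpha_n < \frac12$. Let $$A := \bigg\{ \alpha_{j_k} + \sum_{i=1}^\ell \alpha_{j_i} \ \bigg|\ \ell, j_1, \dots, j_\ell \in \mathbb{N},\ k \in \{1,\dots,\ell\},\ j_1 < \dots < j_\ell \bigg\},$$ let $\beta_0 = 1$, $\beta_\ell := 1 - \sum_{i=1}^\ell \alpha_i$ for $\ell \in \mathbb{N}$, and $B := \{\beta_\ell \mid \ell \in \mathbb{N}_0\}$. Let $M$ be the submonoid of $(\mathbb{R}_{\ge 0}, +)$ generated by $A \cup B$. Then for any field $F$, the monoid domain $F[M]$ is atomic but does not satisfy the ACCP.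
   Context: $\mathbb{N}$ denotes the positive integers and $\mathbb{N}_0$ the nonnegative integers. Thus $A$ consists of all finite sums of terms of $(\alpha_n)$ in which exactly one term appears twice and all other terms appear at most once. $F[M]$ denotes the monoid ring of $M$ over $F$ (polynomial expressions with exponents in $M$ and coefficients in $F$), which is an integral domain. An integral domain is atomic if every nonzero nonunit factors as a finite product of irreducibles; it satisfies the ascending chain condition on principal ideals (ACCP) if every ascending chain of principal ideals eventually stabilizes. *)

theory Defs
  imports
    Complex_Main
    "HOL-Library.Poly_Mapping"
    "HOL-Algebra.Ring_Divisibility"
begin

text \<open>
  The sequence \<open>\<alpha>\<close> is a function on \<^typ>\<open>nat\<close> of which only the values at positive indices are
  used; \<open>\<alpha> 0\<close> is irrelevant throughout.
\<close>

definition doubled_sums :: "(nat \<Rightarrow> real) \<Rightarrow> real set" where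
  "doubled_sums \<alpha> =
     {\<alpha> (j k) + (\<Sum>i = 1..l. \<alpha> (j i)) | (l::nat) (j::nat \<Rightarrow> nat) (k::nat).
        1 \<le> l \<and> k \<in> {1..l} \<and> j ` {1..l} \<subseteq> {1..} \<and> strict_mono_on {1..l} j}"

definition complement_sum :: "(nat \<Rightarrow> real) \<Rightarrow> nat \<Rightarrow> real" where
  "complement_sum \<alpha> l = 1 - (\<Sum>i = 1..l. \<alpha> i)"

definition nonneg_real_monoid :: "real monoid" where
  "nonneg_real_monoid = \<lparr>carrier = {0..}, mult = (+), one = 0\<rparr>"

text \<open>
  The intersection of all submonoids of \<open>(\<real>\<^sub>\<ge>\<^sub>0, +)\<close> containing \<open>S\<close>; only meaningful for
  \<open>S \<subseteq> {0..}\<close>, as otherwise there is no such submonoid and the hull is \<^term>\<open>UNIV :: real set\<close>.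
\<close>

definition generated_submonoid :: "real set \<Rightarrow> real set" where
  "generated_submonoid S = (\<lambda>H. submonoid H nonneg_real_monoid) hull S"

definition exponent_monoid :: "(nat \<Rightarrow> real) \<Rightarrow> real set" where
  "exponent_monoid \<alpha> = generated_submonoid (doubled_sums \<alpha> \<union> range (complement_sum \<alpha>))"

text \<open>
  The finitely supported functions \<^typ>\<open>'a \<Rightarrow>\<^sub>0 'f\<close> carry the convolution product and thus form the
  monoid ring of the whole type \<open>'a\<close>; the monoid ring of a submonoid \<open>M\<close> is the subring of the
  elements whose exponents all lie in \<open>M\<close>.
\<close>

definition monoid_ring :: "'a::comm_monoid_add set \<Rightarrow> ('a \<Rightarrow>\<^sub>0 'f::field) ring" where
  "monoid_ring M =
     \<lparr>carrier = {p. Poly_Mapping.keys p \<subseteq> M}, mult = (*), one = 1, zero = 0, add = (+)\<rparr>"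

locale atomic_domain = domain +
  assumes factorization_exists:
    "\<lbrakk>a \<in> carrier R; a \<noteq> \<zero>; a \<notin> Units R\<rbrakk> \<Longrightarrow>
      \<exists>fs. set fs \<subseteq> carrier R \<and> (\<forall>f \<in> set fs. ring_irreducible f) \<and> foldr (\<otimes>) fs \<one> = a"

definition satisfies_ACCP :: "('a, 'b) ring_scheme \<Rightarrow> bool" where
  "satisfies_ACCP R \<longleftrightarrow>
     (\<forall>I :: nat \<Rightarrow> 'a set.
        (\<forall>n. principalideal (I n) R) \<and> (\<forall>n. I n \<subseteq> I (Suc n)) \<longrightarrow>
        (\<exists>N. \<forall>n\<ge>N. I n = I N))"

lemma vector_space_rat_real: "vector_space (\<lambda>(q::rat) (x::real). of_rat q * x)"
  by unfold_locales (simp_all add: algebra_simps of_rat_add of_rat_mult)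

lemma domain_monoid_ring:
  fixes M :: "real set"
  assumes "submonoid M nonneg_real_monoid"
  shows "domain (monoid_ring M :: (real \<Rightarrow>\<^sub>0 'f::field) ring)"
proof -
  have M0: "0 \<in> M" and Madd: "\<And>x y. x \<in> M \<Longrightarrow> y \<in> M \<Longrightarrow> x + y \<in> M"
    using submonoid.one_closed[OF assms] submonoid.m_closed[OF assms]
    by (simp_all add: nonneg_real_monoid_def)
  let ?R = "monoid_ring M :: (real \<Rightarrow>\<^sub>0 'f) ring"
  have neg: "\<exists>y. Poly_Mapping.keys y \<subseteq> M \<and> y + x = 0"
    if "Poly_Mapping.keys x \<subseteq> M" for x :: "real \<Rightarrow>\<^sub>0 'f"
    using that by (intro exI[of _ "- x"]) (auto simp: in_keys_iff)
  have mul: "Poly_Mapping.keys (x * y) \<subseteq> M"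
    if "Poly_Mapping.keys x \<subseteq> M" "Poly_Mapping.keys y \<subseteq> M" for x y :: "real \<Rightarrow>\<^sub>0 'f"
    using keys_mult[of x y] that Madd by blast
  have add: "Poly_Mapping.keys (x + y) \<subseteq> M"
    if "Poly_Mapping.keys x \<subseteq> M" "Poly_Mapping.keys y \<subseteq> M" for x y :: "real \<Rightarrow>\<^sub>0 'f"
    using Poly_Mapping.keys_add[of x y] that by blast
  have "cring ?R"
  proof (rule cringI)
    show "abelian_group ?R"
      by (rule abelian_groupI) (use neg in \<open>auto simp: monoid_ring_def add add_ac dest: subsetD[OF add]\<close>)
    show "comm_monoid ?R"
      by (rule comm_monoidI) (auto simp: monoid_ring_def M0 mult_ac dest: subsetD[OF mul])
  qed (simp add: monoid_ring_def distrib_right)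
  then show ?thesis
    by (intro domain.intro domain_axioms.intro) (auto simp: monoid_ring_def)
qed

end

theory Submission
  imports Defs
begin

text \<open>
  Write \<open>M\<close> for the exponent monoid and \<open>\<beta>\<^sub>l\<close> for the complements \<open>1 - (\<alpha>\<^sub>1 + \<dots> + \<alpha>\<^sub>l)\<close>. Since \<open>1\<close>
  and the \<open>\<alpha>\<^sub>n\<close> are rationally independent, exponents have rational coordinates, which are integers
  on \<open>M\<close>. The coordinate at \<open>1\<close>, called the level below, counts the complements in any expression
  of an element of \<open>M\<close> as a sum of generators.

  The ACCP fails because \<open>2 \<beta>\<^sub>l = 2 \<beta>\<^bsub>l+1\<^esub> + 2 \<alpha>\<^bsub>l+1\<^esub>\<close>, and \<open>2 \<alpha>\<^bsub>l+1\<^esub>\<close> is a doubled sum: the monomials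
  with exponents \<open>2 \<beta>\<^sub>l\<close> generate a strictly ascending chain of principal ideals.

  For atomicity, factors that are not monomials are harmless. The difference between the largest
  and the smallest value of a fixed coordinate on the support is additive in products
  (\<open>spread_mult\<close>), so the sum of these differences over all coordinates is additive too. It is a
  nonnegative integer for nonzero elements of the monoid ring and vanishes only on monomials; hence it
  bounds the number of non-monomial factors. Monomial factors are bounded whenever the support
  contains an exponent \<open>s\<close> of level at most 1. Indeed every factorization of the ring element
  splits \<open>s\<close> into exponents of the factors, and on levels 0 and 1 there is a superadditive weight
  that is at least 1 on nonzero elements (\<open>weight_superadditive\<close>, \<open>weight_ge_1\<close>). So elements with
  such an exponent have factorizations of bounded length only
  (\<open>irreducible_product_if_light_exponent\<close>).

  If all exponents have level at least 2, this may fail, but then a whole complement can be split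
  off. The doubled sums are exactly what makes \<open>\<beta>\<^sub>p + \<beta>\<^sub>q - \<beta>\<^sub>l\<close> an element of \<open>M\<close> for \<open>l > p, q\<close>
  (\<open>two_complements_minus_complement\<close>). Hence \<open>\<beta>\<^sub>l\<close> divides any given exponent of level at least 2
  once \<open>l\<close> is large, and one \<open>l\<close> serves for the whole finite support. Dividing by the monomial with
  exponent \<open>\<beta>\<^sub>l\<close> lowers all levels by 1, so finitely many such steps produce an exponent of level
  at most 1.
\<close>

section \<open>Products of elements of a group ring\<close>

abbreviation keys :: "('a \<Rightarrow>\<^sub>0 'b::zero) \<Rightarrow> 'a set" where "keys \<equiv> Poly_Mapping.keys"
abbreviation lookup :: "('a \<Rightarrow>\<^sub>0 'b::zero) \<Rightarrow> 'a \<Rightarrow> 'b" where "lookup \<equiv> Poly_Mapping.lookup"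

lemma lookup_mult_unique_sum:
  fixes f g :: "'a::ab_group_add \<Rightarrow>\<^sub>0 'b::semiring_0"
  assumes "\<And>x y. x \<in> keys f \<Longrightarrow> y \<in> keys g \<Longrightarrow> x + y = a + b \<Longrightarrow> x = a"
  shows "lookup (f * g) (a + b) = lookup f a * lookup g b"
proof -
  have inner: "Sum_any (\<lambda>q. lookup g q when a + b = l + q) = lookup g (a + b - l)" for l
  proof -
    have "(a + b = l + q) = (q = a + b - l)" for q
      by (auto simp: algebra_simps)
    then show ?thesis by simp
  qed
  have "lookup f l * lookup g (a + b - l) = (lookup f a * lookup g b when l = a)" for l
    using assms[of l "a + b - l"]
    by (cases "l = a"; cases "lookup f l = 0"; cases "lookup g (a + b - l) = 0") (auto simp: in_keys_iff)
  then show ?thesis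
    by (simp add: lookup_mult inner)
qed

text \<open>
  Ties between exponents with maximal \<open>\<phi>\<close> are broken by the order of the exponents themselves.
  The leading exponents for this lexicographic order can be summed to \<open>a + b\<close> in one way only, so
  their product term does not cancel.
\<close>

lemma keys_mult_maximal:
  fixes f g :: "'a::linordered_ab_group_add \<Rightarrow>\<^sub>0 'b::semiring_no_zero_divisors"
    and \<phi> :: "'a \<Rightarrow> 'c::linordered_ab_group_add"
  assumes add: "\<And>x y. \<phi> (x + y) = \<phi> x + \<phi> y" and "f \<noteq> 0" "g \<noteq> 0"
  obtains a b where "a \<in> keys f" "b \<in> keys g" "a + b \<in> keys (f * g)"
    "\<And>x. x \<in> keys f \<Longrightarrow> \<phi> x \<le> \<phi> a" "\<And>y. y \<in> keys g \<Longrightarrow> \<phi> y \<le> \<phi> b"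
proof -
  have top: "\<exists>a\<in>keys h. \<forall>x\<in>keys h. \<phi> x < \<phi> a \<or> \<phi> x = \<phi> a \<and> x \<le> a"
    if "h \<noteq> 0" for h :: "'a \<Rightarrow>\<^sub>0 'b"
  proof -
    let ?m = "Max (\<phi> ` keys h)"
    let ?T = "{x \<in> keys h. \<phi> x = ?m}"
    have ne: "keys h \<noteq> {}" using that by simp
    then have "?m \<in> \<phi> ` keys h" by (intro Max_in) auto
    then have "?T \<noteq> {}" by auto
    then have T: "Max ?T \<in> ?T" by (intro Max_in) auto
    have "\<phi> x < \<phi> (Max ?T) \<or> \<phi> x = \<phi> (Max ?T) \<and> x \<le> Max ?T" if "x \<in> keys h" for x
    proof -
      have "\<phi> x \<le> ?m" using that by (intro Max_ge) auto
      then show ?thesis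
        using T that by (cases "\<phi> x = ?m") (auto intro!: Max_ge simp: less_le)
    qed
    then show ?thesis using T by blast
  qed
  obtain a where a: "a \<in> keys f" "\<forall>x\<in>keys f. \<phi> x < \<phi> a \<or> \<phi> x = \<phi> a \<and> x \<le> a"
    using top[OF \<open>f \<noteq> 0\<close>] by blast
  obtain b where b: "b \<in> keys g" "\<forall>x\<in>keys g. \<phi> x < \<phi> b \<or> \<phi> x = \<phi> b \<and> x \<le> b"
    using top[OF \<open>g \<noteq> 0\<close>] by blast
  have "x = a" if xy: "x \<in> keys f" "y \<in> keys g" "x + y = a + b" for x y
  proof -
    have "\<phi> x + \<phi> y = \<phi> a + \<phi> b" using xy(3) add by metis
    moreover have "\<phi> x \<le> \<phi> a" "\<phi> y \<le> \<phi> b" using a b xy by force+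
    ultimately have "\<phi> x = \<phi> a" "\<phi> y = \<phi> b"
      by (metis add_less_le_mono add_le_less_mono order_le_less order_less_irrefl)+
    then have "x \<le> a" "y \<le> b" using a b xy by auto
    then show ?thesis
      using xy(3) by (metis add_less_le_mono order_le_less order_less_irrefl)
  qed
  then have "lookup (f * g) (a + b) = lookup f a * lookup g b"
    by (rule lookup_mult_unique_sum)
  then have "a + b \<in> keys (f * g)" using a b by (simp add: in_keys_iff)
  with a b show thesis by (intro that[of a b]) force+
qed

definition spread :: "('a \<Rightarrow> rat) \<Rightarrow> ('a \<Rightarrow>\<^sub>0 'b::zero) \<Rightarrow> rat" where
  "spread \<phi> f = Max (\<phi> ` keys f) - Min (\<phi> ` keys f)"

lemma spread_eqI:
  assumes "a \<in> keys f" "b \<in> keys f" "\<And>x. x \<in> keys f \<Longrightarrow> \<phi> x \<le> \<phi> a" "\<And>x. x \<in> keys f \<Longrightarrow> \<phi> b \<le> \<phi> x"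
  shows "spread \<phi> f = \<phi> a - \<phi> b"
proof -
  have "Max (\<phi> ` keys f) = \<phi> a" "Min (\<phi> ` keys f) = \<phi> b"
    using assms by (auto intro!: Max_eqI Min_eqI)
  then show ?thesis by (simp add: spread_def)
qed

lemma spread_ge: "x \<in> keys f \<Longrightarrow> y \<in> keys f \<Longrightarrow> \<phi> x - \<phi> y \<le> spread \<phi> f"
  unfolding spread_def by (intro diff_mono Max_ge Min_le) auto

lemma spread_nonneg: "f \<noteq> 0 \<Longrightarrow> 0 \<le> spread \<phi> f"
  using spread_ge[of _ f _ \<phi>] by (metis diff_self keys_eq_empty ex_in_conv)

text \<open>
  Maxima of \<open>\<phi>\<close> over supports add up by the previous argument, and so do minima, which are maxima
  for \<open>- \<phi>\<close>.
\<close>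

lemma spread_mult:
  fixes f g :: "'a::linordered_ab_group_add \<Rightarrow>\<^sub>0 'b::semiring_no_zero_divisors"
  assumes add: "\<And>x y. \<phi> (x + y) = \<phi> x + \<phi> y" and "f \<noteq> 0" "g \<noteq> 0"
  shows "spread \<phi> (f * g) = spread \<phi> f + spread \<phi> g"
proof -
  obtain a b where ab: "a \<in> keys f" "b \<in> keys g" "a + b \<in> keys (f * g)"
    "\<And>x. x \<in> keys f \<Longrightarrow> \<phi> x \<le> \<phi> a" "\<And>y. y \<in> keys g \<Longrightarrow> \<phi> y \<le> \<phi> b"
    using keys_mult_maximal[OF assms] by blast
  have "- \<phi> (x + y) = - \<phi> x + - \<phi> y" for x y by (simp add: add)
  then obtain a' b' where ab': "a' \<in> keys f" "b' \<in> keys g" "a' + b' \<in> keys (f * g)"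
    "\<And>x. x \<in> keys f \<Longrightarrow> - \<phi> x \<le> - \<phi> a'" "\<And>y. y \<in> keys g \<Longrightarrow> - \<phi> y \<le> - \<phi> b'"
    using keys_mult_maximal[of "\<lambda>x. - \<phi> x" f g] assms by blast
  have range: "\<phi> x \<le> \<phi> (a + b)" "\<phi> (a' + b') \<le> \<phi> x" if "x \<in> keys (f * g)" for x
  proof -
    obtain y z where yz: "y \<in> keys f" "z \<in> keys g" "x = y + z"
      using keys_mult[of f g] \<open>x \<in> keys (f * g)\<close> by blast
    show "\<phi> x \<le> \<phi> (a + b)" "\<phi> (a' + b') \<le> \<phi> x"
      using ab(4)[OF yz(1)] ab(5)[OF yz(2)] ab'(4)[OF yz(1)] ab'(5)[OF yz(2)]
      by (simp_all add: yz(3) add)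
  qed
  have "spread \<phi> f = \<phi> a - \<phi> a'" "spread \<phi> g = \<phi> b - \<phi> b'"
    using ab ab' by (auto intro!: spread_eqI)
  moreover have "spread \<phi> (f * g) = \<phi> (a + b) - \<phi> (a' + b')"
    using ab ab' range by (intro spread_eqI) auto
  ultimately show ?thesis by (simp add: add)
qed

definition total_spread :: "('i \<Rightarrow> 'a \<Rightarrow> rat) \<Rightarrow> ('a \<Rightarrow>\<^sub>0 'b::zero) \<Rightarrow> rat" where
  "total_spread c f = Sum_any (\<lambda>i. spread (c i) f)"

lemma finite_spread_support:
  assumes "\<And>x. finite {i. c i x \<noteq> 0}" "f \<noteq> 0"
  shows "finite {i. spread (c i) f \<noteq> 0}"
proof (rule finite_subset)
  show "finite (\<Union>x\<in>keys f. {i. c i x \<noteq> 0})" using assms by auto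
  have "spread (c i) f = 0" if "\<And>x. x \<in> keys f \<Longrightarrow> c i x = 0" for i
  proof -
    obtain a where "a \<in> keys f" using assms(2) by (metis keys_eq_empty ex_in_conv)
    with that show ?thesis using spread_eqI[of a f a "c i"] by simp
  qed
  then show "{i. spread (c i) f \<noteq> 0} \<subseteq> (\<Union>x\<in>keys f. {i. c i x \<noteq> 0})" by blast
qed

lemma total_spread_mult:
  fixes f g :: "'a::linordered_ab_group_add \<Rightarrow>\<^sub>0 'b::semiring_no_zero_divisors"
  assumes "\<And>i x y. c i (x + y) = c i x + c i y" "\<And>x. finite {i. c i x \<noteq> 0}" "f \<noteq> 0" "g \<noteq> 0"
  shows "total_spread c (f * g) = total_spread c f + total_spread c g"
  unfolding total_spread_def
  using assms by (simp add: spread_mult Sum_any.distrib finite_spread_support)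

lemma spread_le_total_spread:
  assumes "\<And>x. finite {i. c i x \<noteq> 0}" "f \<noteq> 0"
  shows "spread (c i) f \<le> total_spread c f"
proof -
  let ?S = "insert i {i. spread (c i) f \<noteq> 0}"
  have "total_spread c f = sum (\<lambda>i. spread (c i) f) ?S"
    unfolding total_spread_def
    using finite_spread_support[OF assms] by (intro Sum_any.expand_superset) auto
  moreover have "spread (c i) f \<le> sum (\<lambda>i. spread (c i) f) ?S"
    using finite_spread_support[OF assms] spread_nonneg[OF assms(2)]
    by (intro member_le_sum) auto
  ultimately show ?thesis by simp
qed

lemma total_spread_nonneg:
  assumes "f \<noteq> 0"
  shows "0 \<le> total_spread c f"
  unfolding total_spread_def Sum_any.expand_set
  using spread_nonneg[OF assms] by (intro sum_nonneg) auto

text \<open>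
  This is the reason for summing over all coordinates: two distinct exponents differ in some
  coordinate, by an integer.
\<close>

lemma total_spread_ge_1:
  assumes fin: "\<And>x. finite {i. c i x \<noteq> 0}"
    and inject: "\<And>x y. (\<And>i. c i x = c i y) \<Longrightarrow> x = y"
    and int: "\<And>i x. x \<in> keys f \<Longrightarrow> c i x \<in> \<int>"
    and xy: "x \<in> keys f" "y \<in> keys f" "x \<noteq> y"
  shows "1 \<le> total_spread c f"
proof -
  obtain i where i: "c i x \<noteq> c i y" using inject xy(3) by blast
  have "c i x - c i y \<in> \<int>" using int xy by simp
  then have "1 \<le> \<bar>c i x - c i y\<bar>" using i by (intro Ints_nonzero_abs_ge1) auto
  also have "\<dots> \<le> spread (c i) f"
    using spread_ge[OF xy(1,2), of "c i"] spread_ge[OF xy(2,1), of "c i"] by linarith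
  also have "\<dots> \<le> total_spread c f"
    using xy by (intro spread_le_total_spread fin) auto
  finally show ?thesis .
qed

section \<open>The exponent monoid in rational coordinates\<close>

text \<open>
  Here \<open>c b x\<close> is the coordinate of \<open>x\<close> at the vector \<open>b\<close> of a rational basis of the reals that
  contains \<open>1\<close> and all \<open>\<alpha>\<^sub>n\<close>. Coordinates are indexed by basis vectors rather than by \<open>n\<close>, and are
  defined on all reals, so that injectivity and finite support hold without restriction to \<open>M\<close>.
\<close>

locale coordinatized_exponents =
  fixes \<alpha> :: "nat \<Rightarrow> real" and c :: "real \<Rightarrow> real \<Rightarrow> rat"
  assumes alpha_inj: "inj_on \<alpha> {1..}"
    and alpha_pos: "1 \<le> n \<Longrightarrow> 0 < \<alpha> n"
    and alpha_ne_1: "1 \<le> n \<Longrightarrow> \<alpha> n \<noteq> 1"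
    and complement_pos: "0 < complement_sum \<alpha> l"
    and c_add: "c b (x + y) = c b x + c b y"
    and c_finite: "finite {b. c b x \<noteq> 0}"
    and c_inject: "(\<And>b. c b x = c b y) \<Longrightarrow> x = y"
    and c_one: "c b 1 = of_bool (b = 1)"
    and c_alpha: "1 \<le> n \<Longrightarrow> c b (\<alpha> n) = of_bool (b = \<alpha> n)"
begin

abbreviation M :: "real set" where "M \<equiv> exponent_monoid \<alpha>"
abbreviation \<beta> :: "nat \<Rightarrow> real" where "\<beta> \<equiv> complement_sum \<alpha>"

lemma doubled_sumsE:
  assumes "x \<in> doubled_sums \<alpha>"
  obtains k T where "finite T" "T \<subseteq> {1..}" "k \<in> T" "x = \<alpha> k + sum \<alpha> T"
proof -
  obtain l k :: nat and j where *: "x = \<alpha> (j k) + (\<Sum>i = 1..l. \<alpha> (j i))" "k \<in> {1..l}" "j ` {1..l} \<subseteq> {1..}"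
    "strict_mono_on {1..l} j"
    using assms unfolding doubled_sums_def mem_Collect_eq by (elim exE conjE) (rule that, assumption+)
  have "sum \<alpha> (j ` {1..l}) = (\<Sum>i = 1..l. \<alpha> (j i))"
    using strict_mono_on_imp_inj_on[OF *(4)] by (simp add: sum.reindex)
  with * show thesis by (intro that[of "j ` {1..l}" "j k"]) auto
qed

lemma interval_doubled_sum:
  assumes "p \<le> q"
  shows "\<alpha> (Suc q) + (\<Sum>i = Suc p..Suc q. \<alpha> i) \<in> doubled_sums \<alpha>"
proof -
  have "(\<Sum>i = Suc p..Suc q. \<alpha> i) = (\<Sum>i = 1..Suc q - p. \<alpha> (p + i))"
    using assms
    by (intro sum.reindex_bij_witness[of _ "\<lambda>i. p + i" "\<lambda>i. i - p"]) auto
  then show ?thesis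
    unfolding doubled_sums_def
    using assms
    by (intro CollectI exI[of _ "Suc q - p"] exI[of _ "\<lambda>i. p + i"])
       (auto simp: strict_mono_on_def)
qed

lemma doubled_sums_nonneg: "x \<in> doubled_sums \<alpha> \<Longrightarrow> 0 \<le> x"
  by (elim doubled_sumsE) (auto intro!: add_nonneg_nonneg sum_nonneg less_imp_le[OF alpha_pos])

lemma submonoid_M: "submonoid M nonneg_real_monoid"
  unfolding exponent_monoid_def generated_submonoid_def hull_def
proof (rule submonoid.intro)
  have "submonoid {0..} nonneg_real_monoid"
    by (rule submonoid.intro) (auto simp: nonneg_real_monoid_def)
  moreover have "doubled_sums \<alpha> \<union> range \<beta> \<subseteq> {0..}"
    using doubled_sums_nonneg complement_pos by (auto intro: less_imp_le)
  moreover have "carrier nonneg_real_monoid = {0..}"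
    by (simp add: nonneg_real_monoid_def)
  ultimately show "\<Inter> {t. submonoid t nonneg_real_monoid \<and> doubled_sums \<alpha> \<union> range \<beta> \<subseteq> t}
      \<subseteq> carrier nonneg_real_monoid"
    by (auto intro: Inter_lower)
qed (auto intro: submonoid.m_closed submonoid.one_closed)

lemma M_zero: "0 \<in> M"
  and M_add: "x \<in> M \<Longrightarrow> y \<in> M \<Longrightarrow> x + y \<in> M"
  and M_nonneg: "x \<in> M \<Longrightarrow> 0 \<le> x"
  using submonoid.one_closed[OF submonoid_M] submonoid.m_closed[OF submonoid_M]
    submonoid.subset[OF submonoid_M]
  by (auto simp: nonneg_real_monoid_def)

lemma M_doubled: "x \<in> doubled_sums \<alpha> \<Longrightarrow> x \<in> M"
  and M_complement: "\<beta> l \<in> M"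
  unfolding exponent_monoid_def generated_submonoid_def by (auto intro: hull_inc)

lemma M_induct [consumes 1, case_names zero add doubled complement]:
  assumes "x \<in> M" "P 0"
    and "\<And>x y. x \<in> M \<Longrightarrow> y \<in> M \<Longrightarrow> P x \<Longrightarrow> P y \<Longrightarrow> P (x + y)"
    and "\<And>k T. finite T \<Longrightarrow> T \<subseteq> {1..} \<Longrightarrow> k \<in> T \<Longrightarrow> \<alpha> k + sum \<alpha> T \<in> M \<Longrightarrow> P (\<alpha> k + sum \<alpha> T)"
    and "\<And>l. P (\<beta> l)"
  shows "P x"
proof -
  have "x \<in> {x \<in> M. P x}"
    using assms(1)[unfolded exponent_monoid_def generated_submonoid_def]
  proof (rule hull_induct)
    show "submonoid {x. x \<in> {x \<in> M. P x}} nonneg_real_monoid"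
      by (rule submonoid.intro)
         (use assms M_zero M_add M_nonneg in \<open>auto simp: nonneg_real_monoid_def\<close>)
  next
    fix y assume "y \<in> doubled_sums \<alpha> \<union> range \<beta>"
    moreover from this have "y \<in> M" using M_doubled M_complement by auto
    ultimately show "y \<in> {x \<in> M. P x}"
      using assms(4,5) by (auto elim!: doubled_sumsE)
  qed
  then show ?thesis by simp
qed

lemma c_zero: "c b 0 = 0"
  using c_add[of b 0 0] by simp

lemma c_minus: "c b (- x) = - c b x"
  using c_add[of b x "- x"] by (simp add: c_zero)

lemma c_diff: "c b (x - y) = c b x - c b y"
  using c_add[of b x "- y"] by (simp add: c_minus)

lemma c_sum_alpha:
  assumes "finite T" "T \<subseteq> {1..}"
  shows "c b (sum \<alpha> T) = of_bool (b \<in> \<alpha> ` T)"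
  using assms
proof (induction T rule: finite_induct)
  case (insert n T)
  then have "\<alpha> n \<notin> \<alpha> ` T"
    using alpha_inj by (auto simp: inj_on_def)
  with insert show ?case
    by (auto simp: c_add c_alpha) (metis imageI)
qed (simp add: c_zero)

lemma c_complement: "c b (\<beta> l) = of_bool (b = 1) - of_bool (b \<in> \<alpha> ` {1..l})"
  unfolding complement_sum_def by (subst c_diff, subst c_sum_alpha) (auto simp: c_one)

lemma c_doubled:
  assumes "finite T" "T \<subseteq> {1..}" "k \<in> T"
  shows "c b (\<alpha> k + sum \<alpha> T) = of_bool (b = \<alpha> k) + of_bool (b \<in> \<alpha> ` T)"
  using assms by (subst c_add, subst c_sum_alpha) (auto simp: c_alpha)

lemma c_1_doubled:
  assumes "finite T" "T \<subseteq> {1..}" "k \<in> T"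
  shows "c 1 (\<alpha> k + sum \<alpha> T) = 0"
  using c_doubled[OF assms, of 1] alpha_ne_1 assms by (auto dest: sym)

lemma c_1_complement: "c 1 (\<beta> l) = 1"
  using alpha_ne_1 by (auto simp: c_complement dest: sym)

lemma c_Ints: "x \<in> M \<Longrightarrow> c b x \<in> \<int>"
proof (induction x rule: M_induct)
  case (doubled k T)
  then show ?case by (simp only: c_doubled) (simp add: of_bool_def)
qed (simp_all add: c_zero c_add c_complement of_bool_def)

lemma c_1_nonneg: "x \<in> M \<Longrightarrow> 0 \<le> c 1 x"
proof (induction x rule: M_induct)
  case (doubled k T)
  then show ?case by (simp only: c_1_doubled)
qed (simp_all add: c_zero c_add c_1_complement)

text \<open>
  A negative coordinate can only come from complements, and each complement contributes at worst
  \<open>-1\<close> to a given coordinate.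
\<close>

lemma c_lower_bound: "x \<in> M \<Longrightarrow> b \<noteq> 1 \<Longrightarrow> - c 1 x \<le> c b x"
proof (induction x rule: M_induct)
  case (doubled k T)
  then show ?case by (simp add: c_1_doubled) (simp add: c_doubled)
next
  case (complement l)
  then show ?case by (simp add: c_1_complement) (simp add: c_complement)
qed (auto simp: c_zero c_add)

lemma c_1_cases:
  assumes "x \<in> M"
  obtains "c 1 x = 0" | "c 1 x = 1" | "2 \<le> c 1 x"
proof -
  obtain z :: int where "c 1 x = of_int z" using c_Ints[OF assms] by (auto elim: Ints_cases)
  moreover have "0 \<le> z" using c_1_nonneg[OF assms] calculation by simp
  then have "z = 0 \<or> z = 1 \<or> 2 \<le> z" by linarith
  ultimately show thesis using that by auto
qed

text \<open>
  An element of level 0 is a sum of doubled sums, whose coordinates are nonnegative; the doubled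
  term of any one of them makes some coordinate at least 2.
\<close>

lemma large_coordinate:
  assumes "x \<in> M"
  shows "x = 0 \<or> 1 \<le> c 1 x \<or> (\<exists>b. b \<noteq> 1 \<and> 2 \<le> c b x)"
  using assms
proof (induction x rule: M_induct)
  case (add x y)
  show ?case
  proof (cases "c 1 x = 0 \<and> c 1 y = 0")
    case True
    then have "0 \<le> c b x" "0 \<le> c b y" if "b \<noteq> 1" for b
      using c_lower_bound[of x b] c_lower_bound[of y b] add that by auto
    then show ?thesis using add True by (fastforce simp: c_add)
  next
    case False
    then have "1 \<le> c 1 x \<or> 1 \<le> c 1 y"
      using c_1_cases[OF add(1)] c_1_cases[OF add(2)] by fastforce
    then show ?thesis
      using c_1_nonneg[OF add(1)] c_1_nonneg[OF add(2)] by (auto simp: c_add)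
  qed
next
  case (doubled k T)
  then have "2 \<le> c (\<alpha> k) (\<alpha> k + sum \<alpha> T)" by (simp add: c_doubled)
  moreover have "\<alpha> k \<noteq> 1" using doubled alpha_ne_1 by auto
  ultimately show ?case by blast
qed (auto simp: c_1_complement)

text \<open>
  On level 0 each coordinate counts only as far as it exceeds 1, which for a doubled sum amounts to
  1 in total. Adding an element of level 1 may cancel 1 from any coordinate, and the excess over 1
  is exactly what survives; there a coordinate counts as far as it exceeds 0. From level 2 on,
  infinitely many coordinates would contribute.
\<close>

definition weight :: "real \<Rightarrow> rat" where
  "weight x = c 1 x + Sum_any (\<lambda>b. max 0 (c b x + c 1 x - 1) when b \<noteq> 1)"

lemma weight_support_subset:
  "c 1 x \<le> 1 \<Longrightarrow> {b. (max 0 (c b x + c 1 x - 1) when b \<noteq> 1) \<noteq> 0} \<subseteq> {b. c b x \<noteq> 0}"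
  by auto

text \<open>
  At most one of the summands has level 1. If \<open>x\<close> does, then coordinatewise
  \<open>max 0 u + max 0 (v - 1) \<le> max 0 (u + v)\<close> for \<open>u \<ge> -1\<close> and \<open>v \<ge> 0\<close>; on level 0 the inequality is
  \<open>max 0 (u - 1) + max 0 (v - 1) \<le> max 0 (u + v - 1)\<close> for \<open>u, v \<ge> 0\<close>.
\<close>

lemma weight_superadditive:
  assumes "x \<in> M" "y \<in> M" "c 1 (x + y) \<le> 1"
  shows "weight x + weight y \<le> weight (x + y)"
proof -
  let ?t = "\<lambda>x b. max 0 (c b x + c 1 x - 1) when b \<noteq> 1"
  \<comment> \<open>A common finite index set for the three sums.\<close>
  let ?S = "{b. c b x \<noteq> 0} \<union> {b. c b y \<noteq> 0} \<union> {b. c b (x + y) \<noteq> 0}"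
  have fin: "finite ?S" using c_finite by auto
  have m: "c 1 x = 0 \<and> c 1 y = 0 \<or> c 1 x = 1 \<and> c 1 y = 0 \<or> c 1 x = 0 \<and> c 1 y = 1"
    using assms(3) by (cases rule: c_1_cases[OF assms(1)]; cases rule: c_1_cases[OF assms(2)]) (auto simp: c_add)
  have "?t x b + ?t y b \<le> ?t (x + y) b" for b
    using m c_lower_bound[OF assms(1), of b] c_lower_bound[OF assms(2), of b]
    by (cases "b = 1") (auto simp: c_add max_def)
  then have le: "sum (?t x) ?S + sum (?t y) ?S \<le> sum (?t (x + y)) ?S"
    by (simp add: sum.distrib[symmetric] sum_mono)
  have eq: "Sum_any (?t z) = sum (?t z) ?S" if "z \<in> {x, y, x + y}" for z
  proof (rule Sum_any.expand_superset[OF fin])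
    have "c 1 z \<le> 1" using that m by (auto simp: c_add)
    from weight_support_subset[OF this] show "{b. ?t z b \<noteq> 0} \<subseteq> ?S" using that by blast
  qed
  have "Sum_any (?t x) + Sum_any (?t y) \<le> Sum_any (?t (x + y))"
    using le eq[of x] eq[of y] eq[of "x + y"] by simp
  then show ?thesis unfolding weight_def using c_add[of 1 x y] by linarith
qed

lemma weight_nonneg: "x \<in> M \<Longrightarrow> 0 \<le> weight x"
  unfolding weight_def Sum_any.expand_set
  by (intro add_nonneg_nonneg c_1_nonneg sum_nonneg) (auto simp: when_def)

lemma weight_ge_1:
  assumes "x \<in> M" "x \<noteq> 0" "c 1 x \<le> 1"
  shows "1 \<le> weight x"
proof (cases "1 \<le> c 1 x")
  case True
  moreover have "0 \<le> Sum_any (\<lambda>b. max 0 (c b x + c 1 x - 1) when b \<noteq> 1)"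
    unfolding Sum_any.expand_set by (intro sum_nonneg) (auto simp: when_def)
  ultimately show ?thesis by (simp add: weight_def)
next
  case False
  then obtain b where b: "b \<noteq> 1" "2 \<le> c b x"
    using large_coordinate assms by blast
  let ?t = "\<lambda>b. max 0 (c b x + c 1 x - 1) when b \<noteq> 1"
  have "Sum_any ?t = sum ?t {b. c b x \<noteq> 0}"
    by (rule Sum_any.expand_superset[OF c_finite weight_support_subset[OF assms(3)]])
  moreover have "?t b \<le> sum ?t {b. c b x \<noteq> 0}"
    using b c_finite[of x] by (intro member_le_sum) (auto simp: when_def)
  moreover have "1 \<le> ?t b" using b c_1_nonneg[OF assms(1)] by simp
  ultimately show ?thesis using c_1_nonneg[OF assms(1)] by (simp add: weight_def)
qed

lemma complement_Suc: "\<beta> l = \<beta> (Suc l) + \<alpha> (Suc l)"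
  by (simp add: complement_sum_def)

lemma complement_diff: "p \<le> q \<Longrightarrow> \<beta> p - \<beta> q = (\<Sum>i = Suc p..q. \<alpha> i)"
  by (induction q rule: dec_induct) (auto simp: complement_sum_def)

lemma twice_alpha_in_M: "2 * \<alpha> (Suc l) \<in> M"
  using M_doubled[OF interval_doubled_sum[of l l]] by simp

text \<open>
  For \<open>p \<le> q < l\<close>,
  \<open>\<beta>\<^sub>p + \<beta>\<^sub>q - 2 \<beta>\<^sub>l = (\<alpha>\<^bsub>p+1\<^esub> + \<dots> + \<alpha>\<^bsub>q+1\<^esub> + \<alpha>\<^bsub>q+1\<^esub>) + 2 \<alpha>\<^bsub>q+2\<^esub> + \<dots> + 2 \<alpha>\<^sub>l\<close>
  is a sum of doubled sums. The difference \<open>\<beta>\<^sub>p - \<beta>\<^sub>l\<close> alone has each term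
  just once and is not in \<open>M\<close>.
\<close>

lemma two_complements_minus_complement:
  assumes "p < l" "q < l"
  shows "\<beta> p + \<beta> q - \<beta> l \<in> M"
proof -
  have ordered: "\<beta> p + \<beta> q - 2 * \<beta> l \<in> M" if "p \<le> q" "Suc q \<le> l" for p q
    using that(2)
  proof (induction l rule: dec_induct)
    case base
    have "\<beta> p + \<beta> q - 2 * \<beta> (Suc q) = \<alpha> (Suc q) + (\<Sum>i = Suc p..Suc q. \<alpha> i)"
      using complement_diff[of p "Suc q"] complement_Suc[of q] that(1) by simp
    then show ?case using M_doubled interval_doubled_sum[OF that(1)] by simp
  next
    case (step l)
    then show ?case using M_add[OF _ twice_alpha_in_M[of l]] complement_Suc[of l]
      by (fastforce simp: algebra_simps)
  qed
  have "\<beta> p + \<beta> q - 2 * \<beta> l \<in> M"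
    using ordered[of p q] ordered[of q p] assms by (cases "p \<le> q") (auto simp: add.commute)
  from M_add[OF this M_complement[of l]] show ?thesis by simp
qed

lemma split_off_complement:
  assumes "x \<in> M"
  shows "c 1 x = 0 \<or> (\<exists>p. x - \<beta> p \<in> M)"
  using assms
proof (induction x rule: M_induct)
  case (add x y)
  have "x + y - \<beta> p = (x - \<beta> p) + y" "x + y - \<beta> p = x + (y - \<beta> p)" for p by auto
  then show ?case using add M_add by (metis add_0 c_add)
next
  case (complement l)
  have "\<beta> l - \<beta> l \<in> M" using M_zero by simp
  then show ?case by blast
qed (simp_all only: c_zero c_1_doubled simp_thms)

lemma minus_complement_in_M:
  assumes "x \<in> M" "2 \<le> c 1 x"
  shows "\<forall>\<^sub>F l in sequentially. x - \<beta> l \<in> M"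
proof -
  obtain p where p: "x - \<beta> p \<in> M" using split_off_complement assms by fastforce
  then have "c 1 (x - \<beta> p) \<noteq> 0" using assms by (auto simp: c_diff c_1_complement)
  then obtain q where q: "x - \<beta> p - \<beta> q \<in> M" using split_off_complement[OF p] by blast
  have "x - \<beta> l \<in> M" if "p < l" "q < l" for l
    using M_add[OF q two_complements_minus_complement[OF that]] by simp
  then show ?thesis
    by (intro eventually_sequentiallyI[of "Suc (max p q)"]) auto
qed

lemma common_complement:
  assumes "finite S" "S \<subseteq> M" "\<And>x. x \<in> S \<Longrightarrow> 2 \<le> c 1 x"
  obtains l where "\<And>x. x \<in> S \<Longrightarrow> x - \<beta> l \<in> M"
proof -
  have "\<forall>\<^sub>F l in sequentially. \<forall>x\<in>S. x - \<beta> l \<in> M"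
    using assms minus_complement_in_M by (intro eventually_ball_finite) auto
  then show thesis using that by (auto simp: eventually_sequentially)
qed

section \<open>Atomicity\<close>

abbreviation R :: "(real \<Rightarrow>\<^sub>0 'f::field) ring" where
  "R \<equiv> monoid_ring M"

sublocale R: domain "R :: (real \<Rightarrow>\<^sub>0 'f::field) ring"
  by (rule domain_monoid_ring[OF submonoid_M])

definition irreducible_product :: "(real \<Rightarrow>\<^sub>0 'f::field) \<Rightarrow> bool" where
  "irreducible_product f \<longleftrightarrow> (\<exists>fs. set fs \<subseteq> carrier R \<and> (\<forall>p\<in>set fs. ring_irreducible\<^bsub>R\<^esub> p) \<and>
     foldr (\<otimes>\<^bsub>R\<^esub>) fs \<one>\<^bsub>R\<^esub> = f)"

lemma irreducible_product_mult:
  fixes f g :: "real \<Rightarrow>\<^sub>0 'f::field"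
  assumes "irreducible_product f" "irreducible_product g"
  shows "irreducible_product (f * g)"
proof -
  obtain fs gs :: "(real \<Rightarrow>\<^sub>0 'f) list" where
    fs: "set fs \<subseteq> carrier R" "\<forall>p\<in>set fs. ring_irreducible\<^bsub>R\<^esub> p" "foldr (*) fs 1 = f" and
    gs: "set gs \<subseteq> carrier R" "\<forall>p\<in>set gs. ring_irreducible\<^bsub>R\<^esub> p" "foldr (*) gs 1 = g"
    using assms unfolding irreducible_product_def by (auto simp: monoid_ring_def)
  have "foldr (*) fs h = foldr (*) fs 1 * h" for h
    by (induction fs) (auto simp: mult.assoc)
  from this[of g] fs gs show ?thesis
    unfolding irreducible_product_def
    by (intro exI[of _ "fs @ gs"]) (auto simp: monoid_ring_def)
qed

lemma irreducible_product_irreducible: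
  assumes "f \<in> carrier R" "ring_irreducible\<^bsub>R\<^esub> f"
  shows "irreducible_product f"
  unfolding irreducible_product_def using assms
  by (intro exI[of _ "[f]"]) (auto simp: monoid_ring_def)

lemma constant_in_Units:
  fixes f :: "real \<Rightarrow>\<^sub>0 'f::field"
  assumes "keys f = {0}"
  shows "f \<in> Units R"
proof -
  define a where "a = lookup f 0"
  have "a \<noteq> 0" using assms by (simp add: a_def flip: in_keys_iff)
  have f: "f = Poly_Mapping.single 0 a"
  proof (rule poly_mapping_eqI)
    fix k
    have "k \<noteq> 0 \<Longrightarrow> lookup f k = 0" using assms by (simp flip: not_in_keys_iff_lookup_eq_zero)
    then show "lookup f k = lookup (Poly_Mapping.single 0 a) k"
      by (cases "k = 0") (simp_all add: a_def lookup_single)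
  qed
  define g :: "real \<Rightarrow>\<^sub>0 'f" where "g = Poly_Mapping.single 0 (1 / a)"
  have "g * f = 1" "f * g = 1"
    using f \<open>a \<noteq> 0\<close> by (simp_all add: g_def mult_single)
  moreover have "keys g \<subseteq> M" "keys f \<subseteq> M"
    using assms M_zero by (simp_all add: g_def)
  ultimately show ?thesis
    by (auto simp: Units_def monoid_ring_def)
qed

text \<open>
  Either the support has two exponents and the spread is at least 1, or \<open>f\<close> is a monomial whose
  exponent is nonzero because \<open>f\<close> is not a unit, and the weight is at least 1.
\<close>

lemma weight_plus_spread_ge_1:
  fixes f :: "real \<Rightarrow>\<^sub>0 'f::field"
  assumes f: "f \<in> carrier R" "f \<notin> Units R" and s: "s \<in> keys f" "c 1 s \<le> 1"
  shows "1 \<le> weight s + total_spread c f"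
proof -
  have M: "keys f \<subseteq> M" using f(1) by (simp add: monoid_ring_def)
  have pos: "0 \<le> weight s" "0 \<le> total_spread c f"
    using s M weight_nonneg total_spread_nonneg[of f c] by force+
  show ?thesis
  proof (cases "keys f = {s}")
    case True
    then have "s \<noteq> 0" using f(2) constant_in_Units by blast
    with s M weight_ge_1 pos show ?thesis by fastforce
  next
    case False
    then obtain t where "t \<in> keys f" "s \<noteq> t" using s by blast
    then have "1 \<le> total_spread c f"
      using s(1) M c_Ints c_inject by (intro total_spread_ge_1[of c f s t] c_finite) auto
    with pos show ?thesis by simp
  qed
qed

text \<open>
  If \<open>f = g * h\<close> with nonunits \<open>g\<close> and \<open>h\<close>, then \<open>s = a + b\<close> for exponents \<open>a\<close> of \<open>g\<close> and \<open>b\<close> of \<open>h\<close>,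
  again of level at most 1. The quantity \<open>weight s + total_spread c f\<close> is at least the sum of the
  corresponding quantities for \<open>(g, a)\<close> and \<open>(h, b)\<close>, each of which is at least 1. So both are
  smaller by at least 1, and splitting must stop.
\<close>

lemma irreducible_product_if_light_exponent:
  fixes f :: "real \<Rightarrow>\<^sub>0 'f::field"
  assumes "f \<in> carrier R" "f \<notin> Units R" "s \<in> keys f" "c 1 s \<le> 1"
  shows "irreducible_product f"
proof -
  have "irreducible_product f"
    if "f \<in> carrier R" "f \<notin> Units R" "s \<in> keys f" "c 1 s \<le> 1" "weight s + total_spread c f \<le> of_nat n"
    for f :: "real \<Rightarrow>\<^sub>0 'f" and s n
    using that
  proof (induction n arbitrary: f s)
    case 0
    then show ?case using weight_plus_spread_ge_1[of f s] by simp
  next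
    case (Suc n)
    show ?case
    proof (cases "ring_irreducible\<^bsub>R\<^esub> f")
      case True
      with Suc.prems show ?thesis by (intro irreducible_product_irreducible)
    next
      case False
      have "f \<noteq> 0" using Suc.prems by auto
      with False Suc.prems R.ring_irreducibleI[of f] obtain g h where
        gh: "g \<in> carrier R" "h \<in> carrier R" "f = g * h" "g \<notin> Units R" "h \<notin> Units R"
        by (auto simp: monoid_ring_def)
      have M: "keys g \<subseteq> M" "keys h \<subseteq> M" using gh by (auto simp: monoid_ring_def)
      obtain a b where ab: "a \<in> keys g" "b \<in> keys h" "s = a + b"
        using Suc.prems(3) keys_mult[of g h] gh by blast
      have ab_M: "a \<in> M" "b \<in> M" using ab M by auto
      have light: "c 1 a \<le> 1" "c 1 b \<le> 1"
        using Suc.prems(4) c_1_nonneg[OF ab_M(1)] c_1_nonneg[OF ab_M(2)] by (auto simp: ab c_add)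
      have "total_spread c f = total_spread c g + total_spread c h"
        unfolding gh(3) using \<open>f \<noteq> 0\<close> gh(3) by (intro total_spread_mult c_add c_finite) auto
      moreover have "weight a + weight b \<le> weight s"
        using Suc.prems(4) ab ab_M by (auto intro: weight_superadditive)
      moreover have "1 \<le> weight a + total_spread c g" "1 \<le> weight b + total_spread c h"
        using gh ab light by (auto intro: weight_plus_spread_ge_1)
      ultimately have "weight a + total_spread c g \<le> of_nat n" "weight b + total_spread c h \<le> of_nat n"
        using Suc.prems(5) by auto
      with Suc.IH gh ab light have "irreducible_product g" "irreducible_product h" by blast+
      then show ?thesis unfolding gh(3) by (rule irreducible_product_mult)
    qed
  qed
  moreover obtain n where "weight s + total_spread c f \<le> of_nat n"
    using real_arch_simple by blast
  ultimately show ?thesis using assms by blast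
qed

lemma monomial_irreducible_product: "irreducible_product (Poly_Mapping.single (\<beta> l) (1::'f::field))"
proof (rule irreducible_product_if_light_exponent)
  show "Poly_Mapping.single (\<beta> l) 1 \<notin> Units (R :: (real \<Rightarrow>\<^sub>0 'f) ring)"
  proof
    assume "Poly_Mapping.single (\<beta> l) 1 \<in> Units (R :: (real \<Rightarrow>\<^sub>0 'f) ring)"
    then obtain h :: "real \<Rightarrow>\<^sub>0 'f" where h: "keys h \<subseteq> M" "Poly_Mapping.single (\<beta> l) 1 * h = 1"
      by (auto simp: Units_def monoid_ring_def)
    have "0 \<in> keys (Poly_Mapping.single (\<beta> l) 1 * h)" unfolding h by (simp add: in_keys_iff)
    then obtain k where "k \<in> keys h" "0 = \<beta> l + k"
      using keys_mult[of "Poly_Mapping.single (\<beta> l) 1" h] by auto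
    with h M_nonneg[of k] complement_pos[of l] show False by auto
  qed
qed (use M_complement c_1_complement in \<open>auto simp: monoid_ring_def\<close>)

text \<open>
  Induction on the level of an arbitrary exponent: when every level is at least 2, some monomial
  with exponent \<open>\<beta>\<^sub>l\<close>, itself a product of irreducibles, can be split off.
\<close>

lemma irreducible_product_nonunit:
  fixes f :: "real \<Rightarrow>\<^sub>0 'f::field"
  assumes "f \<in> carrier R" "f \<notin> Units R" "f \<noteq> 0"
  shows "irreducible_product f"
proof -
  have "irreducible_product f"
    if "f \<in> carrier R" "f \<notin> Units R" "s \<in> keys f" "c 1 s \<le> of_nat n"
    for f :: "real \<Rightarrow>\<^sub>0 'f" and s n
    using that
  proof (induction n arbitrary: f s)
    case 0
    then show ?case by (intro irreducible_product_if_light_exponent[of f s]) auto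
  next
    case (Suc n)
    have M: "keys f \<subseteq> M" using Suc.prems by (simp add: monoid_ring_def)
    show ?case
    proof (cases "\<exists>t\<in>keys f. c 1 t \<le> 1")
      case True
      with Suc.prems show ?thesis by (auto intro: irreducible_product_if_light_exponent)
    next
      case False
      have "2 \<le> c 1 t" if "t \<in> keys f" for t
      proof -
        have "t \<in> M" "\<not> c 1 t \<le> 1" using that M False by auto
        from this(1) show ?thesis
          by (rule c_1_cases) (use \<open>\<not> c 1 t \<le> 1\<close> in simp_all)
      qed
      then obtain l where l: "\<And>t. t \<in> keys f \<Longrightarrow> t - \<beta> l \<in> M"
        using common_complement[of "keys f"] M by auto
      \<comment> \<open>The group ring of all reals contains the inverse of the monomial.\<close>
      define h where "h = f * Poly_Mapping.single (- \<beta> l) 1"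
      have f: "f = Poly_Mapping.single (\<beta> l) 1 * h"
        by (simp add: h_def mult.left_commute mult_single)
      have h: "h \<in> carrier R"
        using l keys_mult[of f "Poly_Mapping.single (- \<beta> l) 1"] by (auto simp: h_def monoid_ring_def)
      obtain t where t: "t \<in> keys h" "s = \<beta> l + t"
        using Suc.prems(3) f keys_mult[of "Poly_Mapping.single (\<beta> l) 1" h] by auto
      have "c 1 t \<le> of_nat n" using Suc.prems(4) t by (simp add: c_add c_1_complement)
      show ?thesis
      proof (cases "h \<in> Units R")
        case True
        \<comment> \<open>A unit has exponent 0, so \<open>\<beta> l\<close>, which has level 1, would be an exponent of \<open>f\<close>.\<close>
        then obtain k where k: "k \<in> carrier R" "h * k = 1"
          by (auto simp: Units_def monoid_ring_def)
        then obtain u v where uv: "u \<in> keys h" "v \<in> keys k" "0 = u + v"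
          using keys_mult[of h k] by fastforce
        have "u \<in> M" "v \<in> M" using uv h k by (auto simp: monoid_ring_def)
        then have "u = 0" using uv(3) M_nonneg[of u] M_nonneg[of v] by linarith
        with uv(1) obtain t where "t \<in> keys f" "0 = t + - \<beta> l"
          using keys_mult[of f "Poly_Mapping.single (- \<beta> l) 1"] by (auto simp: h_def)
        moreover from this have "c 1 t \<le> 1" by (simp add: c_1_complement)
        ultimately show ?thesis using \<open>\<not> (\<exists>t\<in>keys f. c 1 t \<le> 1)\<close> by blast
      next
        case False
        then have "irreducible_product h"
          using Suc.IH h t \<open>c 1 t \<le> of_nat n\<close> by blast
        with monomial_irreducible_product show ?thesis
          unfolding f by (rule irreducible_product_mult)
      qed
    qed
  qed
  moreover obtain s where "s \<in> keys f" using assms(3) by (metis keys_eq_empty ex_in_conv)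
  moreover obtain n where "c 1 s \<le> of_nat n" using real_arch_simple by blast
  ultimately show ?thesis using assms by blast
qed

section \<open>An ascending chain of principal ideals\<close>

lemma not_ACCP: "\<not> satisfies_ACCP (R :: (real \<Rightarrow>\<^sub>0 'f::field) ring)"
proof
  let ?R = "R :: (real \<Rightarrow>\<^sub>0 'f) ring"
  define x :: "nat \<Rightarrow> (real \<Rightarrow>\<^sub>0 'f)" where "x n = Poly_Mapping.single (2 * \<beta> n) 1" for n
  have x: "x n \<in> carrier ?R" for n
    using M_add[OF M_complement[of n] M_complement[of n]] by (simp add: x_def monoid_ring_def)
  have step: "PIdl\<^bsub>?R\<^esub> (x n) \<subseteq> PIdl\<^bsub>?R\<^esub> (x (Suc n))" for n
  proof (rule R.cgenideal_minimal[OF R.cgenideal_ideal[OF x]])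
    have "x n = Poly_Mapping.single (2 * \<alpha> (Suc n)) 1 * x (Suc n)"
      using complement_Suc[of n] by (simp add: x_def mult_single add.commute)
    then show "x n \<in> PIdl\<^bsub>?R\<^esub> (x (Suc n))"
      using twice_alpha_in_M[of n] by (auto simp: cgenideal_def monoid_ring_def)
  qed
  have strict: "x (Suc n) \<notin> PIdl\<^bsub>?R\<^esub> (x n)" for n
  proof
    assume "x (Suc n) \<in> PIdl\<^bsub>?R\<^esub> (x n)"
    then obtain h :: "real \<Rightarrow>\<^sub>0 'f" where h: "keys h \<subseteq> M" "x (Suc n) = h * x n"
      by (auto simp: cgenideal_def monoid_ring_def)
    have "2 * \<beta> (Suc n) \<in> keys (h * x n)"
      unfolding h(2)[symmetric] by (simp add: x_def)
    then obtain k where "k \<in> keys h" "2 * \<beta> (Suc n) = k + 2 * \<beta> n"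
      using keys_mult[of h "x n"] by (auto simp: x_def)
    with h M_nonneg[of k] complement_Suc[of n] alpha_pos[of "Suc n"] show False by auto
  qed
  assume "satisfies_ACCP ?R"
  then obtain N where N: "\<forall>n\<ge>N. PIdl\<^bsub>?R\<^esub> (x n) = PIdl\<^bsub>?R\<^esub> (x N)"
    unfolding satisfies_ACCP_def
    using step R.cgenideal_is_principalideal[OF x]
    by (elim allE[of _ "\<lambda>n. PIdl\<^bsub>?R\<^esub> (x n)"]) auto
  have "PIdl\<^bsub>?R\<^esub> (x (Suc N)) = PIdl\<^bsub>?R\<^esub> (x N)" by (rule N[rule_format]) simp
  with strict[of N] R.cgenideal_self[OF x[of "Suc N"]] show False by simp
qed

lemma atomic_domain_R: "atomic_domain (R :: (real \<Rightarrow>\<^sub>0 'f::field) ring)"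
proof (intro atomic_domain.intro atomic_domain_axioms.intro)
  show "domain (R :: (real \<Rightarrow>\<^sub>0 'f) ring)" by (rule R.domain_axioms)
next
  fix f :: "real \<Rightarrow>\<^sub>0 'f"
  assume "f \<in> carrier R" "f \<noteq> \<zero>\<^bsub>R\<^esub>" "f \<notin> Units R"
  then have "irreducible_product f"
    by (intro irreducible_product_nonunit) (auto simp: monoid_ring_def)
  then show "\<exists>fs. set fs \<subseteq> carrier R \<and> (\<forall>p\<in>set fs. ring_irreducible\<^bsub>R\<^esub> p) \<and>
      foldr (\<otimes>\<^bsub>R\<^esub>) fs \<one>\<^bsub>R\<^esub> = f"
    by (simp add: irreducible_product_def)
qed

end

section \<open>Coordinates from rational independence\<close>

lemma independent_coordinates:
  fixes S :: "real set"
  assumes "module.independent (\<lambda>(q::rat) (x::real). of_rat q * x) S"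
  obtains c :: "real \<Rightarrow> real \<Rightarrow> rat" where "\<And>b x y. c b (x + y) = c b x + c b y"
    "\<And>x. finite {b. c b x \<noteq> 0}" "\<And>x y. (\<And>b. c b x = c b y) \<Longrightarrow> x = y"
    "\<And>b v. v \<in> S \<Longrightarrow> c b v = of_bool (b = v)"
proof -
  interpret V: vector_space "\<lambda>(q::rat) (x::real). of_rat q * x"
    by (rule vector_space_rat_real)
  let ?B = "V.extend_basis S"
  have B: "V.independent ?B" "V.span ?B = UNIV" "S \<subseteq> ?B"
    using assms V.independent_extend_basis V.span_extend_basis V.extend_basis_superset by auto
  show thesis
  proof (rule that[of "\<lambda>b x. V.representation ?B x b"])
    show "x = y" if "\<And>b. V.representation ?B x b = V.representation ?B y b" for x y
    proof -
      have sum_eq: "(\<Sum>b | V.representation ?B v b \<noteq> 0. of_rat (V.representation ?B v b) * b) = v" for v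
        by (rule V.sum_nonzero_representation_eq) (simp_all add: B)
      have "V.representation ?B x = V.representation ?B y" using that by (rule ext)
      from sum_eq[of x, unfolded this] show ?thesis by (simp only: sum_eq)
    qed
  qed (use B V.finite_representation in \<open>auto simp: V.representation_add V.representation_basis subset_iff\<close>)
qed

theorem theorem4p4:
  fixes \<alpha> :: "nat \<Rightarrow> real"
  assumes "inj_on \<alpha> {1..}"
    and "\<And>n. 1 \<le> n \<Longrightarrow> 0 < \<alpha> n"
    and "\<And>n. 1 \<le> n \<Longrightarrow> \<alpha> n \<notin> \<rat>"
    and "module.independent (\<lambda>(q::rat) (x::real). of_rat q * x) ({1} \<union> \<alpha> ` {1..})"
    and "summable (\<lambda>n. \<alpha> (Suc n))"
    and "suminf (\<lambda>n. \<alpha> (Suc n)) < 1 / 2"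
  shows "atomic_domain (monoid_ring (exponent_monoid \<alpha>) :: (real \<Rightarrow>\<^sub>0 'f::field) ring) \<and>
    \<not> satisfies_ACCP (monoid_ring (exponent_monoid \<alpha>) :: (real \<Rightarrow>\<^sub>0 'f::field) ring)"
proof -
  obtain c :: "real \<Rightarrow> real \<Rightarrow> rat" where c: "\<And>b x y. c b (x + y) = c b x + c b y"
    "\<And>x. finite {b. c b x \<noteq> 0}" "\<And>x y. (\<And>b. c b x = c b y) \<Longrightarrow> x = y"
    "\<And>b v. v \<in> {1} \<union> \<alpha> ` {1..} \<Longrightarrow> c b v = of_bool (b = v)"
    using independent_coordinates[OF assms(4)] by blast
  have complement_pos: "0 < complement_sum \<alpha> l" for l
  proof -
    have "(\<Sum>i = 1..l. \<alpha> i) = (\<Sum>n<l. \<alpha> (Suc n))"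
      by (intro sum.reindex_bij_witness[of _ Suc "\<lambda>i. i - 1"]) auto
    also have "\<dots> \<le> suminf (\<lambda>n. \<alpha> (Suc n))"
      using assms(2,5) by (intro sum_le_suminf) (auto intro: less_imp_le)
    finally show ?thesis using assms(6) by (simp add: complement_sum_def)
  qed
  have alpha_ne_1: "\<alpha> n \<noteq> 1" if "1 \<le> n" for n
    using assms(3)[OF that] by auto
  interpret coordinatized_exponents \<alpha> c
  proof (rule coordinatized_exponents.intro)
    show "c b 1 = of_bool (b = 1)" for b by (rule c(4)) simp
    show "c b (\<alpha> n) = of_bool (b = \<alpha> n)" if "1 \<le> n" for b n by (rule c(4)) (use that in simp)
  qed (fact assms(1) assms(2) alpha_ne_1 complement_pos c(1) c(2) c(3))+
  show ?thesis using atomic_domain_R not_ACCP by blast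
qed

end
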